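(* Let $\mathbb{I}\in\{\mathbb{Q},\mathbb{R}\}$, $N\ge 1$, and let $\mathbf{m}^+$ be a coherent $2N\times 2N$ DBM over $\overline{\mathbb{I}}=\mathbb{I}\cup\{+\infty\}$ with $\mathcal{D}^+(\mathbf{m}^+)\neq\emptyset$. Let $(\mathbf{m}^+)^\bullet$ be the output of the strong closure algorithm on $\mathbf{m}^+$. Then: 1. $\mathbf{m}^+=(\mathbf{m}^+)^\bullet$ if and only if $\mathbf{m}^+$ is strongly closed. 2. (Saturation) For all $i,j$, if $(\mathbf{m}^+)^\bullet_{ij}\neq+\infty$, then there exists $(s_0,\ldots,s_{2N-1})\in\mathcal{D}(\mathbf{m}^+)$ such that $s_{2k}=-s_{2k+1}$ for all $k\in\{0,\ldots,N-1\}$ and $s_j-s_i=(\mathbf{m}^+)^\bullet_{ij}$. 3. (Normal form) $(\mathbf{m}^+)^\bullet=\inf_{\trianglelefteq}\{\mathbf{n}^+\mid \mathbf{n}^+ \text{ is a coherent } 2N\times 2N \text{ DBM over } \overline{\mathbb{I}} \text{ and } \mathcal{D}^+(\mathbf{n}^+)=\mathcal{D}^+(\mathbf{m}^+)\}$.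
   Context: A Difference-Bound Matrix (DBM) is a square matrix with entries in $\overline{\mathbb{I}}=\mathbb{I}\cup\{+\infty\}$, indexed from $0$. The order $\trianglelefteq$ on DBMs of the same size is the point-wise one: $\mathbf{m}\trianglelefteq\mathbf{n}$ iff $\mathbf{m}_{ij}\le\mathbf{n}_{ij}$ for all $i,j$; infima are taken for this order. For an index $i\in\{0,\ldots,2N-1\}$, $\bar{\imath}$ denotes $i\oplus 1$ (bitwise exclusive or), i.e. $\overline{2k}=2k+1$ and $\overline{2k+1}=2k$. A $2N\times 2N$ DBM $\mathbf{m}^+$ is coherent if $\mathbf{m}^+_{ij}=\mathbf{m}^+_{\bar{\jmath}\,\bar{\imath}}$ for all $i,j$. $\mathcal{D}(\mathbf{m}^+)=\{(s_0,\ldots,s_{2N-1})\in\mathbb{I}^{2N}\mid\forall i,j,\ s_j-s_i\le\mathbf{m}^+_{ij}\}$ and $\mathcal{D}^+(\mathbf{m}^+)=\{(s_0,\ldots,s_{N-1})\in\mathbb{I}^N\mid (s_0,-s_0,\ldots,s_{N-1},-s_{N-1})\in\mathcal{D}(\mathbf{m}^+)\}$. $\mathbf{m}^+$ is strongly closed if it is coherent, $\mathbf{m}^+_{ii}=0$ for all $i$, $\mathbf{m}^+_{ij}\le\mathbf{m}^+_{ik}+\mathbf{m}^+_{kj}$ for all $i,j,k$, and $\mathbf{m}^+_{ij}\le(\mathbf{m}^+_{i\bar{\imath}}+\mathbf{m}^+_{\bar{\jmath}j})/2$ for all $i,j$. Strong closure algorithm: $\mathbf{m}^+_0=\mathbf{m}^+$,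 $\mathbf{m}^+_{k+1}=S^+(C^+_{2k}(\mathbf{m}^+_k))$ for $0\le k<N$, and $(\mathbf{m}^+)^\bullet=\mathbf{m}^+_N$, where $[C^+_k(\mathbf{n})]_{ii}=0$; for $i\ne j$, $$[C^+_k(\mathbf{n})]_{ij}=\min\big(\mathbf{n}_{ij},\ \mathbf{n}_{ik}+\mathbf{n}_{kj},\ \mathbf{n}_{i\bar{k}}+\mathbf{n}_{\bar{k}j},\ \mathbf{n}_{ik}+\mathbf{n}_{k\bar{k}}+\mathbf{n}_{\bar{k}j},\ \mathbf{n}_{i\bar{k}}+\mathbf{n}_{\bar{k}k}+\mathbf{n}_{kj}\big);$$ and $[S^+(\mathbf{n})]_{ij}=\min\big(\mathbf{n}_{ij},\ (\mathbf{n}_{i\bar{\imath}}+\mathbf{n}_{\bar{\jmath}j})/2\big)$ for all $i,j$. *)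

theory Defs
  imports "Jordan_Normal_Form.Matrix" "HOL-Algebra.Lattice" "HOL-Library.Extended_Real"
begin

text \<open>
  The coefficient domain is a set \<open>I\<close> of reals, later either \<open>\<rat>\<close> or \<open>\<real>\<close>.  Since the entries of a
  DBM lie in \<open>I \<union> {+\<infinity>}\<close>, the value \<open>-\<infinity>\<close> of the extended reals never occurs, and
  addition, halving and minimum behave as usual with \<open>+\<infinity>\<close> absorbing.
\<close>

definition DBM :: "real set \<Rightarrow> nat \<Rightarrow> ereal mat set" where
  "DBM I n = {m \<in> carrier_mat n n. elements_mat m \<subseteq> ereal ` I \<union> {\<infinity>}}"

text \<open>On matrices of equal size, the order of the library is the point-wise one.\<close>

definition dbm_order :: "real set \<Rightarrow> nat \<Rightarrow> ereal mat gorder" where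
  "dbm_order I n =
     \<lparr>carrier = DBM I n, eq = (=), le = (\<le>)\<rparr>"

definition bar :: "nat \<Rightarrow> nat" where
  "bar i = Bit_Operations.xor i 1"

lemma bar_double [simp]: "bar (2 * k) = Suc (2 * k)" "bar (Suc (2 * k)) = 2 * k"
  unfolding bar_def xor_one_eq by simp_all

text \<open>Below, \<open>N\<close> is the number of program variables; the matrices involved have size \<open>2 * N\<close>.\<close>

definition coherent_dbm :: "nat \<Rightarrow> ereal mat \<Rightarrow> bool" where
  "coherent_dbm N m \<longleftrightarrow> (\<forall>i<2*N. \<forall>j<2*N. m $$ (i, j) = m $$ (bar j, bar i))"

definition dbm_domain :: "real set \<Rightarrow> nat \<Rightarrow> ereal mat \<Rightarrow> real vec set" where
  "dbm_domain I n m =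
     {s \<in> carrier_vec n. set\<^sub>v s \<subseteq> I \<and> (\<forall>i<n. \<forall>j<n. ereal (s $ j - s $ i) \<le> m $$ (i, j))}"

text \<open>The vector \<open>(s\<^sub>0, -s\<^sub>0, s\<^sub>1, -s\<^sub>1, \<dots>)\<close>.\<close>

definition double_vec :: "real vec \<Rightarrow> real vec" where
  "double_vec s = vec (2 * dim_vec s) (\<lambda>i. if even i then s $ (i div 2) else - (s $ (i div 2)))"

definition oct_domain :: "real set \<Rightarrow> nat \<Rightarrow> ereal mat \<Rightarrow> real vec set" where
  "oct_domain I N m =
     {s \<in> carrier_vec N. set\<^sub>v s \<subseteq> I \<and> double_vec s \<in> dbm_domain I (2*N) m}"

definition strongly_closed :: "nat \<Rightarrow> ereal mat \<Rightarrow> bool" where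
  "strongly_closed N m \<longleftrightarrow>
     coherent_dbm N m \<and>
     (\<forall>i<2*N. m $$ (i, i) = 0) \<and>
     (\<forall>i<2*N. \<forall>j<2*N. \<forall>k<2*N. m $$ (i, j) \<le> m $$ (i, k) + m $$ (k, j)) \<and>
     (\<forall>i<2*N. \<forall>j<2*N. m $$ (i, j) \<le> (m $$ (i, bar i) + m $$ (bar j, j)) / 2)"

definition C_plus :: "nat \<Rightarrow> ereal mat \<Rightarrow> ereal mat" where
  "C_plus k n = mat (dim_row n) (dim_col n) (\<lambda>(i, j).
     if i = j then 0
     else Min {n $$ (i, j),
               n $$ (i, k) + n $$ (k, j),
               n $$ (i, bar k) + n $$ (bar k, j),
               n $$ (i, k) + n $$ (k, bar k) + n $$ (bar k, j),
               n $$ (i, bar k) + n $$ (bar k, k) + n $$ (k, j)})"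

definition S_plus :: "ereal mat \<Rightarrow> ereal mat" where
  "S_plus n = mat (dim_row n) (dim_col n) (\<lambda>(i, j).
     min (n $$ (i, j)) ((n $$ (i, bar i) + n $$ (bar j, j)) / 2))"

primrec strong_closure_iter :: "ereal mat \<Rightarrow> nat \<Rightarrow> ereal mat" where
  "strong_closure_iter m 0 = m"
| "strong_closure_iter m (Suc k) = S_plus (C_plus (2 * k) (strong_closure_iter m k))"

definition strong_closure :: "nat \<Rightarrow> ereal mat \<Rightarrow> ereal mat" where
  "strong_closure N m = strong_closure_iter m N"

end

theory Submission
  imports Defs
begin

text \<open>
  A point of the domain is a potential for \<open>m\<close>, so every cycle has nonnegative weight.  Hence
  \<open>C_plus k\<close> is two consecutive Floyd-Warshall pivots, at \<open>k\<close> and \<open>bar k\<close>, followed by clearing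
  the diagonal, and \<open>S_plus\<close> does not destroy the triangle inequalities at the pivots already
  treated, because these come in pairs \<open>c, bar c\<close>.  So the result is strongly closed.  For a
  strongly closed matrix, any admissible difference \<open>s j - s i = c\<close> can be realised by choosing the
  value at \<open>i\<close> in an interval that strong closedness makes nonempty, and this partial solution extends
  to the remaining variables one at a time.  The normal form property follows, since a matrix with
  the same domain must bound all attained differences.
\<close>

section \<open>The index involution and antisymmetric potentials\<close>

lemma bar_bar [simp]: "bar (bar i) = i"
  by (cases "even i") (auto elim!: evenE oddE)

lemma bar_neq [simp]: "bar i \<noteq> i" "i \<noteq> bar i"
  by (cases "even i"; auto elim!: evenE oddE)+

lemma bar_less_double_iff [simp]: "bar i < 2 * N \<longleftrightarrow> i < 2 * N"
  by (cases "even i") (auto elim!: evenE oddE)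

lemma bar_eq_iff [simp]: "bar i = bar j \<longleftrightarrow> i = j"
  by (metis bar_bar)

text \<open>The values are arbitrary reals, so that the closure arguments can use any potential;
  membership in \<open>I\<close> is tracked separately where it matters. A function on indices
  avoids dimension conditions.\<close>

definition octagonal_solution :: "nat \<Rightarrow> ereal mat \<Rightarrow> (nat \<Rightarrow> real) \<Rightarrow> bool" where
  "octagonal_solution N n s \<longleftrightarrow> (\<forall>i<2*N. s (bar i) = - s i) \<and>
     (\<forall>i<2*N. \<forall>j<2*N. ereal (s j - s i) \<le> n $$ (i, j))"

lemma octagonal_solution_mono:
  assumes "octagonal_solution N n s"
    and "\<And>i j. i < 2*N \<Longrightarrow> j < 2*N \<Longrightarrow> n $$ (i, j) \<le> n' $$ (i, j)"
  shows "octagonal_solution N n' s"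
  using assms unfolding octagonal_solution_def by (meson order_trans)

lemma octagonal_solution_cycle_nonneg:
  assumes "octagonal_solution N n s" "i < 2*N" "j < 2*N"
  shows "0 \<le> n $$ (i, i)" "0 \<le> n $$ (i, j) + n $$ (j, i)"
proof -
  have "ereal (s i - s i) \<le> n $$ (i, i)"
    and ij: "ereal (s j - s i) \<le> n $$ (i, j)" "ereal (s i - s j) \<le> n $$ (j, i)"
    using assms unfolding octagonal_solution_def by blast+
  then show "0 \<le> n $$ (i, i)" by (simp add: zero_ereal_def)
  show "0 \<le> n $$ (i, j) + n $$ (j, i)"
    using add_mono[OF ij] by (simp add: zero_ereal_def)
qed

subsection \<open>Closedness under the strong closure algorithm\<close>

text \<open>One simultaneous Floyd-Warshall update, on functions so that two updates compose
  freely.\<close>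

definition pivot :: "nat \<Rightarrow> (nat \<Rightarrow> nat \<Rightarrow> ereal) \<Rightarrow> nat \<Rightarrow> nat \<Rightarrow> ereal" where
  "pivot k f i j = min (f i j) (f i k + f k j)"

text \<open>The Floyd-Warshall loop invariant: endpoints range over all of \<open>V\<close>,
  midpoints only over the pivots \<open>P\<close> treated so far.\<close>

definition closed_at :: "nat set \<Rightarrow> nat set \<Rightarrow> (nat \<Rightarrow> nat \<Rightarrow> ereal) \<Rightarrow> bool" where
  "closed_at V P f \<longleftrightarrow> (\<forall>i\<in>V. \<forall>j\<in>V. \<forall>c\<in>P. f i j \<le> f i c + f c j)"

lemma closed_atD: "closed_at V P f \<Longrightarrow> i \<in> V \<Longrightarrow> j \<in> V \<Longrightarrow> c \<in> P \<Longrightarrow> f i j \<le> f i c + f c j"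
  unfolding closed_at_def by blast

lemma min_add_ereal:
  fixes a b c :: ereal
  shows "min a b + c = min (a + c) (b + c)" "c + min a b = min (c + a) (c + b)"
  by (cases a b rule: linorder_le_cases; simp add: min_absorb1 min_absorb2 add_left_mono add_right_mono)+

text \<open>For an old pivot \<open>c\<close> the right-hand side expands into four paths.
  Closedness at \<open>c\<close> shortens the first three; the fourth contains the walk from
  \<open>k\<close> to \<open>c\<close> and back, which weighs at least \<open>f k k\<close> and so
  can be cut out.\<close>

lemma closed_at_pivot:
  assumes "closed_at V P f" "0 \<le> f k k" "k \<in> V" "P \<subseteq> V"
  shows "closed_at V (insert k P) (pivot k f)"
  unfolding closed_at_def
proof (intro ballI)
  fix i j c
  assume ij: "i \<in> V" "j \<in> V" and "c \<in> insert k P"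
  then consider "c = k" | "c \<in> P" by blast
  then show "pivot k f i j \<le> pivot k f i c + pivot k f c j"
  proof cases
    case 1
    have "f i k \<le> f i k + f k k" "f k j \<le> f k k + f k j"
      using add_left_mono[OF assms(2), of "f i k"] add_right_mono[OF assms(2), of "f k j"] by simp_all
    then have "pivot k f i k = f i k" "pivot k f k j = f k j"
      by (simp_all add: pivot_def)
    then show ?thesis unfolding \<open>c = k\<close> by (simp add: pivot_def)
  next
    case 2
    note closed = closed_atD[OF assms(1) _ _ 2]
    have "f i j \<le> f i c + f c j"
      and ik: "f i k \<le> f i c + f c k" and kj: "f k j \<le> f k c + f c j"
      and "f k k \<le> f k c + f c k"
      using closed ij assms(3) by auto
    then have kk: "0 \<le> f c k + f k c"
      using assms(2) by (simp add: add.commute)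
    have "f i k + f k j \<le> (f i c + f c k) + f k j"
      using ik by (rule add_right_mono)
    moreover have "f i k + f k j \<le> f i k + (f k c + f c j)"
      using kj by (rule add_left_mono)
    moreover have "f i k + f k j \<le> (f i k + f k c) + (f c k + f k j)"
    proof -
      have "f i k + f k j \<le> (f i k + f k j) + f k k"
        using add_left_mono[OF assms(2), of "f i k + f k j"] by simp
      also have "\<dots> \<le> (f i k + f k j) + (f k c + f c k)"
        by (rule add_left_mono) fact
      finally show ?thesis by (simp add: ac_simps)
    qed
    ultimately show ?thesis
      using \<open>f i j \<le> f i c + f c j\<close>
      by (auto simp: pivot_def min_add_ereal min_le_iff_disj ac_simps)
  qed
qed

text \<open>For \<open>i = j\<close> the claim is the nonnegativity of a two-cycle; otherwise the
  midpoint is an endpoint, now joined to itself at cost 0, or no entry involved has changed.\<close>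

lemma closed_at_zero_diagonal:
  assumes "closed_at V P f" "P \<subseteq> V" "\<And>i j. i \<in> V \<Longrightarrow> j \<in> V \<Longrightarrow> 0 \<le> f i j + f j i"
  shows "closed_at V P (\<lambda>i j. if i = j then 0 else f i j)"
  using assms unfolding closed_at_def by auto

section \<open>One round of the algorithm: solutions, coherence and closedness\<close>

lemma C_plus_dim [simp]: "dim_row (C_plus k n) = dim_row n" "dim_col (C_plus k n) = dim_col n"
  by (simp_all add: C_plus_def)

lemma S_plus_dim [simp]: "dim_row (S_plus n) = dim_row n" "dim_col (S_plus n) = dim_col n"
  by (simp_all add: S_plus_def)

lemma C_plus_carrier: "n \<in> carrier_mat r c \<Longrightarrow> C_plus k n \<in> carrier_mat r c"
  and S_plus_carrier: "n \<in> carrier_mat r c \<Longrightarrow> S_plus n \<in> carrier_mat r c"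
  by auto

lemma strong_closure_iter_carrier:
  "m \<in> carrier_mat r c \<Longrightarrow> strong_closure_iter m k \<in> carrier_mat r c"
  by (induction k) auto

lemma C_plus_index:
  assumes "n \<in> carrier_mat (2*N) (2*N)" "i < 2*N" "j < 2*N"
  shows "C_plus k n $$ (i, j) = (if i = j then 0
     else Min {n $$ (i, j), n $$ (i, k) + n $$ (k, j), n $$ (i, bar k) + n $$ (bar k, j),
               n $$ (i, k) + n $$ (k, bar k) + n $$ (bar k, j),
               n $$ (i, bar k) + n $$ (bar k, k) + n $$ (k, j)})"
  using assms by (simp add: C_plus_def)

lemma S_plus_index:
  assumes "n \<in> carrier_mat (2*N) (2*N)" "i < 2*N" "j < 2*N"
  shows "S_plus n $$ (i, j) = min (n $$ (i, j)) ((n $$ (i, bar i) + n $$ (bar j, j)) / 2)"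
  using assms by (simp add: S_plus_def)

text \<open>The composed pivots also produce the path \<open>i, k, bar k, k, j\<close>; it contains a cycle and
  is therefore never shorter than \<open>i, k, j\<close>.\<close>
lemma C_plus_eq_pivots:
  assumes "n \<in> carrier_mat (2*N) (2*N)" "i < 2*N" "j < 2*N"
    and "0 \<le> n $$ (k, bar k) + n $$ (bar k, k)"
  shows "C_plus k n $$ (i, j) =
    (if i = j then 0 else pivot (bar k) (pivot k (\<lambda>i j. n $$ (i, j))) i j)"
proof -
  have "n $$ (i, k) + n $$ (k, j) \<le> n $$ (i, k) + n $$ (k, j) + (n $$ (k, bar k) + n $$ (bar k, k))"
    using add_left_mono[OF assms(4), of "n $$ (i, k) + n $$ (k, j)"] by simp
  then have "n $$ (i, k) + n $$ (k, j)
      \<le> n $$ (i, k) + (n $$ (k, bar k) + (n $$ (bar k, k) + n $$ (k, j)))"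
    by (simp only: ac_simps)
  then show ?thesis
    unfolding C_plus_index[OF assms(1-3)]
    by (cases "i = j"; intro antisym) (auto simp: pivot_def min_add_ereal min_le_iff_disj add.assoc)
qed

text \<open>Each candidate is the weight of a path from \<open>i\<close> to \<open>j\<close>, along
  which the differences of \<open>s\<close> telescope.\<close>

lemma octagonal_solution_C_plus:
  assumes "octagonal_solution N n s" "n \<in> carrier_mat (2*N) (2*N)" "k < 2*N"
  shows "octagonal_solution N (C_plus k n) s"
  unfolding octagonal_solution_def
proof (intro conjI allI impI)
  show "s (bar i) = - s i" if "i < 2*N" for i
    using assms(1) that by (simp add: octagonal_solution_def)
  fix i j assume ij: "i < 2*N" "j < 2*N"
  have *: "ereal (s j - s i) \<le> n $$ (i, j)" if "i < 2*N" "j < 2*N" for i j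
    using assms(1) that by (simp add: octagonal_solution_def)
  have 2: "ereal (s j - s i) \<le> n $$ (i, c) + n $$ (c, j)" if "c < 2*N" for c
    using add_mono[OF *[OF ij(1) that] *[OF that ij(2)]] by simp
  have 3: "ereal (s j - s i) \<le> n $$ (i, c) + n $$ (c, d) + n $$ (d, j)" if "c < 2*N" "d < 2*N" for c d
    using add_mono[OF add_mono[OF *[OF ij(1) that(1)] *[OF that]] *[OF that(2) ij(2)]] by simp
  show "ereal (s j - s i) \<le> C_plus k n $$ (i, j)"
    using * 2 3 ij assms(3) unfolding C_plus_index[OF assms(2) ij] by (auto simp: zero_ereal_def)
qed

text \<open>The two unary entries bound \<open>- 2 * s i\<close> and \<open>2 * s j\<close>, so
  their mean bounds \<open>s j - s i\<close>.\<close>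

lemma octagonal_solution_S_plus:
  assumes "octagonal_solution N n s" "n \<in> carrier_mat (2*N) (2*N)"
  shows "octagonal_solution N (S_plus n) s"
  unfolding octagonal_solution_def
proof (intro conjI allI impI)
  show bar: "s (bar i) = - s i" if "i < 2*N" for i
    using assms(1) that by (simp add: octagonal_solution_def)
  fix i j assume ij: "i < 2*N" "j < 2*N"
  have *: "ereal (s j - s i) \<le> n $$ (i, j)" if "i < 2*N" "j < 2*N" for i j
    using assms(1) that by (simp add: octagonal_solution_def)
  have "ereal (2 * (s j - s i)) \<le> n $$ (i, bar i) + n $$ (bar j, j)"
    using add_mono[OF *[of i "bar i"] *[of "bar j" j]] ij bar by (simp add: right_diff_distrib)
  then have "ereal (s j - s i) \<le> (n $$ (i, bar i) + n $$ (bar j, j)) / 2"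
    by (cases "n $$ (i, bar i) + n $$ (bar j, j)") auto
  then show "ereal (s j - s i) \<le> S_plus n $$ (i, j)"
    using * ij unfolding S_plus_index[OF assms(2) ij] by simp
qed

lemma coherent_dbmD:
  "coherent_dbm N n \<Longrightarrow> i < 2*N \<Longrightarrow> j < 2*N \<Longrightarrow> n $$ (bar j, bar i) = n $$ (i, j)"
  unfolding coherent_dbm_def by metis

text \<open>Passing to \<open>(bar j, bar i)\<close> reverses paths and exchanges \<open>k\<close>
  with \<open>bar k\<close>: the two single-pivot candidates swap and the other three stay
  fixed.\<close>

lemma coherent_C_plus:
  assumes "coherent_dbm N n" "n \<in> carrier_mat (2*N) (2*N)" "k < 2*N"
  shows "coherent_dbm N (C_plus k n)"
  unfolding coherent_dbm_def
proof (intro allI impI)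
  fix i j assume ij: "i < 2*N" "j < 2*N"
  note c = coherent_dbmD[OF assms(1)]
  have "n $$ (bar j, k) = n $$ (bar k, j)" "n $$ (k, bar i) = n $$ (i, bar k)"
    "n $$ (bar j, bar k) = n $$ (k, j)" "n $$ (bar k, bar i) = n $$ (i, k)"
    "n $$ (bar j, bar i) = n $$ (i, j)"
    using c[of "bar k" j] c[of i "bar k"] c[of k j] c[of i k] c[of i j] ij assms(3) by simp_all
  then show "C_plus k n $$ (i, j) = C_plus k n $$ (bar j, bar i)"
    using ij assms(2)
    by (simp add: C_plus_index add.commute add.left_commute min.commute min.left_commute)
qed

lemma coherent_S_plus:
  assumes "coherent_dbm N n" "n \<in> carrier_mat (2*N) (2*N)"
  shows "coherent_dbm N (S_plus n)"
  using assms coherent_dbmD[OF assms(1)]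
  unfolding coherent_dbm_def by (simp add: S_plus_index add.commute)

text \<open>For \<open>j = bar i\<close> both terms of the mean are \<open>n $$ (i, bar i)\<close>.
  Hence the right-hand side of the strengthening inequality survives \<open>S_plus\<close>, and one
  application enforces it.\<close>

lemma S_plus_unary [simp]:
  assumes "n \<in> carrier_mat (2*N) (2*N)" "i < 2*N"
  shows "S_plus n $$ (i, bar i) = n $$ (i, bar i)"
  using assms by (cases "n $$ (i, bar i)") (simp_all add: S_plus_index)

lemma closed_at_C_plus:
  assumes "closed_at {..<2*N} P (\<lambda>i j. n $$ (i, j))" "n \<in> carrier_mat (2*N) (2*N)" "k < 2*N"
    and "octagonal_solution N n s" "P \<subseteq> {..<2*N}"
  shows "closed_at {..<2*N} (insert k (insert (bar k) P)) (\<lambda>i j. C_plus k n $$ (i, j))"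
proof -
  let ?p = "pivot k (\<lambda>i j. n $$ (i, j))"
  let ?q = "pivot (bar k) ?p"
  have cycle: "0 \<le> n $$ (k, bar k) + n $$ (bar k, k)"
    using octagonal_solution_cycle_nonneg[OF assms(4), of k "bar k"] assms(3) by simp
  have p: "closed_at {..<2*N} (insert k P) ?p"
    using octagonal_solution_cycle_nonneg[OF assms(4), of k k] assms by (intro closed_at_pivot) auto
  have "0 \<le> ?p (bar k) (bar k)"
    using octagonal_solution_cycle_nonneg[OF assms(4), of "bar k" k] assms(3) cycle
    by (simp add: pivot_def)
  then have q: "closed_at {..<2*N} (insert (bar k) (insert k P)) ?q"
    using assms(3,5) by (intro closed_at_pivot[OF p]) auto
  \<comment> \<open>\<open>s\<close> stays a potential through both pivots, which yields the
    nonnegative two-cycles needed for clearing the diagonal.\<close>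
  have pot: "ereal (s j - s i) \<le> n $$ (i, j)" if "i < 2*N" "j < 2*N" for i j
    using assms(4) that by (simp add: octagonal_solution_def)
  have pot': "ereal (s j - s i) \<le> ?p i j" if "i < 2*N" "j < 2*N" for i j
    using pot[OF that] add_mono[OF pot[OF that(1) assms(3)] pot[OF assms(3) that(2)]]
    by (simp add: pivot_def)
  have pot'': "ereal (s j - s i) \<le> ?q i j" if "i < 2*N" "j < 2*N" for i j
    using pot'[OF that] add_mono[OF pot'[OF that(1), of "bar k"] pot'[OF _ that(2), of "bar k"]] assms(3)
    by (simp add: pivot_def[of "bar k"])
  have "0 \<le> ?q i j + ?q j i" if "i < 2*N" "j < 2*N" for i j
    using add_mono[OF pot''[OF that] pot''[OF that(2,1)]] by (simp add: zero_ereal_def)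
  then have "closed_at {..<2*N} (insert (bar k) (insert k P)) (\<lambda>i j. if i = j then 0 else ?q i j)"
    using q assms by (intro closed_at_zero_diagonal) auto
  then show ?thesis
    using assms C_plus_eq_pivots[OF assms(2) _ _ cycle]
    unfolding closed_at_def by (auto simp: subset_iff)
qed

lemma ereal_neq_MInfty: "ereal r \<le> a \<Longrightarrow> a \<noteq> - \<infinity>"
  by auto

text \<open>A step through a halved unary bound at a pivot \<open>c\<close> is absorbed because coherence and
  closedness at \<open>c\<close> and \<open>bar c\<close> give \<open>n(i, bar i) \<le> 2 n(i, c) + n(c, bar c)\<close>.\<close>
lemma closed_at_S_plus:
  assumes closed: "closed_at {..<2*N} P (\<lambda>i j. n $$ (i, j))"
    and n: "n \<in> carrier_mat (2*N) (2*N)" "coherent_dbm N n"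
    and s: "octagonal_solution N n s"
    and P: "P \<subseteq> {..<2*N}" "\<And>c. c \<in> P \<Longrightarrow> bar c \<in> P"
  shows "closed_at {..<2*N} P (\<lambda>i j. S_plus n $$ (i, j))"
  unfolding closed_at_def
proof (intro ballI)
  fix i j c
  assume "i \<in> {..<2*N}" "j \<in> {..<2*N}" and c: "c \<in> P"
  then have lt: "i < 2*N" "j < 2*N" "c < 2*N" using P by auto
  have cl: "n $$ (x, y) \<le> n $$ (x, z) + n $$ (z, y)" if "x < 2*N" "y < 2*N" "z \<in> P" for x y z
    using closed_atD[OF closed] that by simp
  have ninf: "n $$ (x, y) \<noteq> -\<infinity>" if "x < 2*N" "y < 2*N" for x y
    using s that unfolding octagonal_solution_def by (metis ereal_neq_MInfty)
  have ic: "n $$ (i, bar i) \<le> n $$ (i, c) + (n $$ (c, bar c) + n $$ (i, c))"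
    using order_trans[OF cl[of i "bar i" c] add_left_mono[OF cl[of c "bar i" "bar c"]]] lt c P(2)[OF c]
      coherent_dbmD[OF n(2), of i c] by simp
  have cj: "n $$ (bar j, j) \<le> n $$ (c, j) + n $$ (bar c, c) + n $$ (c, j)"
    using order_trans[OF cl[of "bar j" j c] add_right_mono[OF cl[of "bar j" c "bar c"]]] lt c P(2)[OF c]
      coherent_dbmD[OF n(2), of c j] by simp
  have cyc: "0 \<le> n $$ (c, bar c) + n $$ (bar c, c)"
    using octagonal_solution_cycle_nonneg[OF s, of c "bar c"] lt by simp
  have nm: "n $$ (i, bar i) \<noteq> -\<infinity>" "n $$ (bar j, j) \<noteq> -\<infinity>" "n $$ (i, c) \<noteq> -\<infinity>" "n $$ (c, j) \<noteq> -\<infinity>"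
     "n $$ (c, bar c) \<noteq> -\<infinity>" "n $$ (bar c, c) \<noteq> -\<infinity>"
    using ninf lt by simp_all
  \<comment> \<open>The sum of two minima has four candidates. The direct one is \<open>cl\<close>;
    \<open>h1\<close>, \<open>h2\<close> and \<open>h3\<close> have the halved step second, first,
    and in both places. In \<open>h3\<close> the nonnegative two-cycle through \<open>c\<close> and
    \<open>bar c\<close> is dropped.\<close>
  have h1: "(n $$ (i, bar i) + n $$ (bar j, j)) / 2 \<le> n $$ (i, c) + (n $$ (c, bar c) + n $$ (bar j, j)) / 2"
    using ic nm
    by (cases "n $$ (i, bar i)"; cases "n $$ (bar j, j)"; cases "n $$ (i, c)"; cases "n $$ (c, bar c)") (auto simp: add_divide_distrib)
  have h2: "(n $$ (i, bar i) + n $$ (bar j, j)) / 2 \<le> (n $$ (i, bar i) + n $$ (bar c, c)) / 2 + n $$ (c, j)"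
    using cj nm
    by (cases "n $$ (i, bar i)"; cases "n $$ (bar j, j)"; cases "n $$ (c, j)"; cases "n $$ (bar c, c)") (auto simp: add_divide_distrib)
  have h3: "(n $$ (i, bar i) + n $$ (bar j, j)) / 2 \<le>
     (n $$ (i, bar i) + n $$ (bar c, c)) / 2 + (n $$ (c, bar c) + n $$ (bar j, j)) / 2"
    using cyc nm
    by (cases "n $$ (i, bar i)"; cases "n $$ (bar j, j)"; cases "n $$ (c, bar c)"; cases "n $$ (bar c, c)") (auto simp: add_divide_distrib)
  show "S_plus n $$ (i, j) \<le> S_plus n $$ (i, c) + S_plus n $$ (c, j)"
    using h1 h2 h3 cl[of i j c] c lt
    by (simp add: S_plus_index[OF n(1)] min_add_ereal min_le_iff_disj)
qed

text \<open>The competing mean is half the weight of the two-cycle through \<open>i\<close> and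
  \<open>bar i\<close>.\<close>

lemma S_plus_diag:
  assumes "n \<in> carrier_mat (2*N) (2*N)" "octagonal_solution N n s" "i < 2*N" "n $$ (i, i) = 0"
  shows "S_plus n $$ (i, i) = 0"
  using octagonal_solution_cycle_nonneg(2)[OF assms(2), of i "bar i"] assms
  by (cases "n $$ (i, bar i) + n $$ (bar i, i)") (auto simp: S_plus_index min_def)

text \<open>The treated pivots grow by the pair \<open>2*k\<close>, \<open>Suc (2*k)\<close> in each
  round. The diagonal and strengthening conditions are produced afresh by each round, hence the
  guard \<open>k > 0\<close>.\<close>

lemma strong_closure_iter_invariant:
  assumes "m \<in> carrier_mat (2*N) (2*N)" "coherent_dbm N m" "octagonal_solution N m s" "k \<le> N"
  defines "n \<equiv> strong_closure_iter m k"
  shows "coherent_dbm N n \<and> octagonal_solution N n s \<and> closed_at {..<2*N} {..<2*k} (\<lambda>i j. n $$ (i, j))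
    \<and> (k > 0 \<longrightarrow> (\<forall>i<2*N. n $$ (i, i) = 0) \<and>
         (\<forall>i<2*N. \<forall>j<2*N. n $$ (i, j) \<le> (n $$ (i, bar i) + n $$ (bar j, j)) / 2))"
  using assms(4) unfolding n_def
proof (induction k)
  case 0
  then show ?case using assms by (simp add: closed_at_def)
next
  case (Suc k)
  let ?n = "strong_closure_iter m k" let ?c = "C_plus (2*k) ?n"
  have n: "?n \<in> carrier_mat (2*N) (2*N)" using assms(1) by (rule strong_closure_iter_carrier)
  then have c: "?c \<in> carrier_mat (2*N) (2*N)" by (rule C_plus_carrier)
  have IH: "coherent_dbm N ?n" "octagonal_solution N ?n s"
    "closed_at {..<2*N} {..<2*k} (\<lambda>i j. ?n $$ (i, j))"
    using Suc by auto
  have k: "2 * k < 2 * N" using Suc.prems by simp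
  have cc: "coherent_dbm N ?c" "octagonal_solution N ?c s"
    using IH n k by (simp_all add: coherent_C_plus octagonal_solution_C_plus)
  have P: "insert (2*k) (insert (bar (2*k)) {..<2*k}) = {..<2 * Suc k}" by auto
  have "closed_at {..<2*N} {..<2 * Suc k} (\<lambda>i j. ?c $$ (i, j))"
    using closed_at_C_plus[OF IH(3) n k IH(2)] k unfolding P by simp
  then have "closed_at {..<2*N} {..<2 * Suc k} (\<lambda>i j. S_plus ?c $$ (i, j))"
    using Suc.prems bar_less_double_iff[of _ "Suc k"] by (intro closed_at_S_plus[OF _ c cc]) auto
  moreover have "S_plus ?c $$ (i, i) = 0" if "i < 2*N" for i
    using that n by (intro S_plus_diag[OF c cc(2)]) (simp_all add: C_plus_index)
  moreover have "S_plus ?c $$ (i, j) \<le> (S_plus ?c $$ (i, bar i) + S_plus ?c $$ (bar j, j)) / 2"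
    if "i < 2*N" "j < 2*N" for i j
    using that S_plus_unary[OF c, of i] S_plus_unary[OF c, of "bar j"]
    by (simp add: S_plus_index[OF c, of i j])
  ultimately show ?case
    using cc c by (simp add: coherent_S_plus octagonal_solution_S_plus)
qed

lemma strongly_closed_strong_closure:
  assumes "m \<in> carrier_mat (2*N) (2*N)" "coherent_dbm N m" "octagonal_solution N m s" "N \<ge> 1"
  shows "strongly_closed N (strong_closure N m)"
  using strong_closure_iter_invariant[OF assms(1-3) order.refl] assms(4)
  unfolding strongly_closed_def strong_closure_def closed_at_def by auto

lemma octagonal_solution_strong_closure:
  assumes "m \<in> carrier_mat (2*N) (2*N)" "coherent_dbm N m" "octagonal_solution N m s"
  shows "octagonal_solution N (strong_closure N m) s"
  using strong_closure_iter_invariant[OF assms order.refl] unfolding strong_closure_def by blast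

text \<open>Off the diagonal the old entry takes part in each minimum; on the diagonal, where
  \<open>C_plus\<close> writes 0, the potential shows that the old entry was nonnegative.\<close>

lemma strong_closure_le:
  assumes m: "m \<in> carrier_mat (2*N) (2*N)" "coherent_dbm N m" "octagonal_solution N m s"
    and ij: "i < 2*N" "j < 2*N"
  shows "strong_closure N m $$ (i, j) \<le> m $$ (i, j)"
proof -
  have "strong_closure_iter m k $$ (i, j) \<le> m $$ (i, j)" if "k \<le> N" for k
    using that
  proof (induction k)
    case (Suc k)
    let ?n = "strong_closure_iter m k"
    have n: "?n \<in> carrier_mat (2*N) (2*N)" using m(1) by (rule strong_closure_iter_carrier)
    have "octagonal_solution N ?n s"
      using strong_closure_iter_invariant[OF m, of k] Suc.prems by simp
    then have "C_plus (2*k) ?n $$ (i, j) \<le> ?n $$ (i, j)"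
      using octagonal_solution_cycle_nonneg(1)[of N ?n s i] ij n by (auto simp: C_plus_index)
    moreover have "S_plus (C_plus (2*k) ?n) $$ (i, j) \<le> C_plus (2*k) ?n $$ (i, j)"
      using n ij by (subst S_plus_index[of _ N]) auto
    ultimately show ?case using Suc by simp
  qed simp
  then show ?thesis by (simp add: strong_closure_def)
qed

text \<open>Every candidate path and every mean is at least the direct entry, so each minimum
  returns that entry.\<close>

lemma strong_closure_of_strongly_closed:
  assumes m: "m \<in> carrier_mat (2*N) (2*N)" "strongly_closed N m"
  shows "strong_closure N m = m"
proof -
  have tri: "m $$ (i, j) \<le> m $$ (i, k) + m $$ (k, j)" if "i < 2*N" "j < 2*N" "k < 2*N" for i j k
    using m(2) that unfolding strongly_closed_def by blast
  have C: "C_plus k m = m" if k: "k < 2*N" for k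
  proof (rule eq_matI)
    fix i j assume "i < dim_row m" "j < dim_col m"
    then have ij: "i < 2*N" "j < 2*N" using m(1) by auto
    have "m $$ (i, j) \<le> m $$ (i, c) + m $$ (c, d) + m $$ (d, j)" if "c < 2*N" "d < 2*N" for c d
      using order_trans[OF tri[OF ij that(2)] add_right_mono[OF tri[OF ij(1) that(2,1)]]] .
    then show "C_plus k m $$ (i, j) = m $$ (i, j)"
      using ij k tri m(2) unfolding C_plus_index[OF m(1) ij] strongly_closed_def
      by (auto intro!: Min_eqI)
  qed simp_all
  have S: "S_plus m = m"
    using m by (intro eq_matI) (auto simp: S_plus_index[of _ N] strongly_closed_def)
  have "strong_closure_iter m k = m" if "k \<le> N" for k
    using that by (induction k) (simp_all add: C S)
  then show ?thesis by (simp add: strong_closure_def)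
qed

subsection \<open>Saturation\<close>

text \<open>This treats rationals and reals together. Halving is needed because unary bounds
  constrain \<open>2 * s i\<close>; \<open>one_mem\<close> supplies the natural numbers used as
  arbitrarily large differences.\<close>

locale half_closed_group =
  fixes I :: "real set"
  assumes one_mem: "1 \<in> I"
    and diff_mem: "a \<in> I \<Longrightarrow> b \<in> I \<Longrightarrow> a - b \<in> I"
    and half_mem: "a \<in> I \<Longrightarrow> a / 2 \<in> I"
begin

lemma zero_mem: "0 \<in> I"
  using diff_mem[OF one_mem one_mem] by simp

lemma uminus_mem: "a \<in> I \<Longrightarrow> - a \<in> I"
  using diff_mem[OF zero_mem] by simp

lemma add_mem: "a \<in> I \<Longrightarrow> b \<in> I \<Longrightarrow> a + b \<in> I"
  using diff_mem[OF _ uminus_mem] by simp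

lemma of_nat_mem: "real n \<in> I"
  by (induction n) (auto intro: zero_mem add_mem one_mem)

definition upper_values :: "ereal set" where
  "upper_values = ereal ` I \<union> {\<infinity>}"

lemma upper_values_cases:
  assumes "a \<in> upper_values"
  obtains r where "r \<in> I" "a = ereal r" | "a = \<infinity>"
  using assms unfolding upper_values_def by blast

lemma upper_values_neq_MInfty: "a \<in> upper_values \<Longrightarrow> a \<noteq> - \<infinity>"
  by (auto elim: upper_values_cases)

lemma ereal_mem_upper_values: "x \<in> I \<Longrightarrow> ereal x \<in> upper_values"
  and zero_mem_upper_values: "0 \<in> upper_values"
  using zero_mem by (auto simp: upper_values_def zero_ereal_def)

lemma add_mem_upper_values: "a \<in> upper_values \<Longrightarrow> b \<in> upper_values \<Longrightarrow> a + b \<in> upper_values"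
  by (auto elim!: upper_values_cases intro: add_mem simp: upper_values_def)

lemma infinity_mem_upper_values: "\<infinity> \<in> upper_values"
  by (simp add: upper_values_def)

lemma half_mem_upper_values: "a \<in> upper_values \<Longrightarrow> a / 2 \<in> upper_values"
  by (erule upper_values_cases)
    (simp_all add: ereal_mem_upper_values half_mem infinity_mem_upper_values)

lemma min_mem_upper_values: "a \<in> upper_values \<Longrightarrow> b \<in> upper_values \<Longrightarrow> min a b \<in> upper_values"
  by (simp add: min_def)

lemmas upper_values_intros = ereal_mem_upper_values zero_mem_upper_values add_mem_upper_values
  half_mem_upper_values half_mem_upper_values[unfolded numeral_eq_ereal] min_mem_upper_values

text \<open>Lower bounds are given by their negations, so that both families lie in
  \<^const>\<open>upper_values\<close>.\<close>
lemma between_finite_bounds: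
  assumes "finite L" "finite U" "L \<subseteq> upper_values" "U \<subseteq> upper_values"
    and le: "\<And>l u. l \<in> L \<Longrightarrow> u \<in> U \<Longrightarrow> 0 \<le> l + u"
  obtains x where "x \<in> I" "\<And>l. l \<in> L \<Longrightarrow> ereal (- x) \<le> l" "\<And>u. u \<in> U \<Longrightarrow> ereal x \<le> u"
proof -
  \<comment> \<open>The value comes from a finite minimum of one family and so lies in
    \<open>I\<close>; if all bounds are infinite, 0 serves.\<close>
  consider "L \<subseteq> {\<infinity>}" "U \<subseteq> {\<infinity>}" | "\<not> L \<subseteq> {\<infinity>}" | "\<not> U \<subseteq> {\<infinity>}" by blast
  then show thesis
  proof cases
    case 1
    then show thesis using that[OF zero_mem] by force
  next
    case 2
    then have mem: "Min L \<in> L" using assms(1) by (intro Min_in) auto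
    have "Min L \<noteq> \<infinity>"
    proof
      assume "Min L = \<infinity>"
      then have "l = \<infinity>" if "l \<in> L" for l using Min_le[OF assms(1) that] by simp
      then show False using 2 by blast
    qed
    then obtain r where r: "r \<in> I" "Min L = ereal r"
      using mem assms(3) by (auto elim: upper_values_cases)
    show thesis
    proof (rule that[OF uminus_mem[OF r(1)]])
      show "ereal (- (- r)) \<le> l" if "l \<in> L" for l
        using Min_le[OF assms(1) that] r by simp
      show "ereal (- r) \<le> u" if "u \<in> U" for u
        using le[OF mem that] r by (cases u) (auto simp: zero_ereal_def)
    qed
  next
    case 3
    then have mem: "Min U \<in> U" using assms(2) by (intro Min_in) auto
    have "Min U \<noteq> \<infinity>"
    proof
      assume "Min U = \<infinity>"
      then have "l = \<infinity>" if "l \<in> U" for l using Min_le[OF assms(2) that] by simp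
      then show False using 3 by blast
    qed
    then obtain r where r: "r \<in> I" "Min U = ereal r"
      using mem assms(4) by (auto elim: upper_values_cases)
    show thesis
    proof (rule that[OF r(1)])
      show "ereal r \<le> u" if "u \<in> U" for u
        using Min_le[OF assms(2) that] r by simp
      show "ereal (- r) \<le> l" if "l \<in> L" for l
        using le[OF that mem] r by (cases l) (auto simp: zero_ereal_def)
    qed
  qed
qed

section \<open>Partial solutions and their extension\<close>

lemma DBM_iff:
  "n \<in> DBM I r \<longleftrightarrow> n \<in> carrier_mat r r \<and> (\<forall>i<r. \<forall>j<r. n $$ (i, j) \<in> upper_values)"
proof (cases "n \<in> carrier_mat r r")
  case True
  have "elements_mat n \<subseteq> upper_values \<longleftrightarrow> (\<forall>i<r. \<forall>j<r. n $$ (i, j) \<in> upper_values)"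
  proof (intro iffI allI impI subsetI)
    fix i j assume "elements_mat n \<subseteq> upper_values" "i < r" "j < r"
    then show "n $$ (i, j) \<in> upper_values" using subsetD[OF _ elements_matI[OF True _ _ refl]] by blast
  next
    fix a assume *: "\<forall>i<r. \<forall>j<r. n $$ (i, j) \<in> upper_values" and "a \<in> elements_mat n"
    then obtain i j where "i < dim_row n" "j < dim_col n" "a = n $$ (i, j)"
      using elements_matD by metis
    then show "a \<in> upper_values" using * carrier_matD[OF True] by simp
  qed
  then show ?thesis
    unfolding DBM_def upper_values_def[symmetric] using True by simp
next
  case False
  then show ?thesis unfolding DBM_def by simp
qed

text \<open>\<open>A\<close> is closed under \<open>bar\<close> since a variable occupies two
  indices. The seeds used later consist of no, one or two variables.\<close>

definition partial_solution :: "ereal mat \<Rightarrow> nat set \<Rightarrow> (nat \<Rightarrow> real) \<Rightarrow> bool" where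
  "partial_solution n A s \<longleftrightarrow> (\<forall>i\<in>A. bar i \<in> A \<and> s i \<in> I \<and> s (bar i) = - s i) \<and>
     (\<forall>i\<in>A. \<forall>j\<in>A. ereal (s j - s i) \<le> n $$ (i, j))"

text \<open>The bounds on a new value \<open>x\<close> at \<open>k\<close> are \<open>x \<le> s i + n(i, k)\<close>,
  \<open>x \<le> n(bar k, k) / 2\<close> and their mirror images; the bounds at \<open>bar k\<close> are the same by coherence.
  They are compatible by closedness.\<close>
lemma partial_solution_extend:
  assumes n: "n \<in> DBM I (2*N)" "strongly_closed N n"
    and A: "A \<subseteq> {..<2*N}" "partial_solution n A s" and k: "k < 2*N" "k \<notin> A"
  obtains s' where "partial_solution n (insert k (insert (bar k) A)) s'"
    "\<And>i. i \<in> A \<Longrightarrow> s' i = s i"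
proof -
  have co: "coherent_dbm N n" and diag: "\<And>i. i < 2*N \<Longrightarrow> n $$ (i, i) = 0"
    and tri: "\<And>i j c. i < 2*N \<Longrightarrow> j < 2*N \<Longrightarrow> c < 2*N \<Longrightarrow> n $$ (i, j) \<le> n $$ (i, c) + n $$ (c, j)"
    using n(2) unfolding strongly_closed_def by blast+
  have val: "n $$ (i, j) \<in> upper_values" if "i < 2*N" "j < 2*N" for i j
    using n(1) that by (simp add: DBM_iff)
  have lt: "i < 2*N" if "i \<in> A" for i using A(1) that by auto
  have barA: "bar i \<in> A" and sI: "s i \<in> I" "- s i \<in> I" and sb: "s (bar i) = - s i" if "i \<in> A" for i
    using A(2) that uminus_mem unfolding partial_solution_def by auto
  have sA: "ereal (s j - s i) \<le> n $$ (i, j)" if "i \<in> A" "j \<in> A" for i j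
    using A(2) that unfolding partial_solution_def by auto
  define L where "L = insert (n $$ (k, bar k) / 2) ((\<lambda>i. ereal (- s i) + n $$ (k, i)) ` A)"
  define U where "U = insert (n $$ (bar k, k) / 2) ((\<lambda>i. ereal (s i) + n $$ (i, k)) ` A)"
  have fin: "finite A" using A(1) finite_subset by blast
  have kk: "0 \<le> n $$ (k, bar k) + n $$ (bar k, k)"
    using tri[of k k "bar k"] diag k by simp
  have ij: "0 \<le> ereal (- s i) + n $$ (k, i) + (ereal (s j) + n $$ (j, k))" if "i \<in> A" "j \<in> A" for i j
    using order_trans[OF sA[of j i] tri[of j i k]] that lt k upper_values_neq_MInfty[OF val]
    by (cases "n $$ (k, i)"; cases "n $$ (j, k)") (auto simp: zero_ereal_def)
  \<comment> \<open>Twice this inequality bounds \<open>2 * s i\<close> by the path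
    \<open>bar i\<close>, \<open>bar k\<close>, \<open>k\<close>, \<open>i\<close>, whose first and
    last edges agree by coherence. \<open>Li\<close> is the mirror image.\<close>
  have iU: "0 \<le> ereal (- s i) + n $$ (k, i) + n $$ (bar k, k) / 2" if "i \<in> A" for i
  proof -
    have "ereal (2 * s i) \<le> n $$ (bar i, i)" using sA[OF barA[OF that] that] by (simp add: sb[OF that])
    also have "\<dots> \<le> n $$ (bar i, bar k) + (n $$ (bar k, k) + n $$ (k, i))"
      using order_trans[OF tri[of "bar i" i "bar k"] add_left_mono[OF tri[of "bar k" i k]]] lt that k
      by simp
    also have "n $$ (bar i, bar k) = n $$ (k, i)" using coherent_dbmD[OF co] lt that k by simp
    finally show ?thesis
      using that lt k upper_values_neq_MInfty[OF val]
      by (cases "n $$ (k, i)"; cases "n $$ (bar k, k)") (auto simp: zero_ereal_def)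
  qed
  have Li: "0 \<le> n $$ (k, bar k) / 2 + (ereal (s i) + n $$ (i, k))" if "i \<in> A" for i
  proof -
    have "ereal (- (2 * s i)) \<le> n $$ (i, bar i)" using sA[OF that barA[OF that]] by (simp add: sb[OF that])
    also have "\<dots> \<le> n $$ (i, k) + (n $$ (k, bar k) + n $$ (bar k, bar i))"
      using order_trans[OF tri[of i "bar i" k] add_left_mono[OF tri[of k "bar i" "bar k"]]] lt that k
      by simp
    also have "n $$ (bar k, bar i) = n $$ (i, k)" using coherent_dbmD[OF co] lt that k by simp
    finally show ?thesis
      using that lt k upper_values_neq_MInfty[OF val]
      by (cases "n $$ (i, k)"; cases "n $$ (k, bar k)") (auto simp: zero_ereal_def)
  qed
  have LU: "0 \<le> n $$ (k, bar k) / 2 + n $$ (bar k, k) / 2"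
    using kk k upper_values_neq_MInfty[OF val]
    by (cases "n $$ (k, bar k)"; cases "n $$ (bar k, k)") (auto simp: zero_ereal_def)
  have "0 \<le> l + u" if "l \<in> L" "u \<in> U" for l u
    using that ij iU Li LU unfolding L_def U_def by auto
  moreover have "L \<subseteq> upper_values" "U \<subseteq> upper_values"
    using lt k sI val unfolding L_def U_def by (auto intro!: upper_values_intros)
  moreover have "finite L" "finite U" using fin by (simp_all add: L_def U_def)
  ultimately obtain x where x: "x \<in> I" "\<And>l. l \<in> L \<Longrightarrow> ereal (- x) \<le> l" "\<And>u. u \<in> U \<Longrightarrow> ereal x \<le> u"
    using between_finite_bounds by metis
  have barkA: "bar k \<notin> A" using barA k(2) by force
  define s' where "s' = s(k := x, bar k := - x)"
  have s'A: "s' i = s i" if "i \<in> A" for i using that k barkA by (auto simp: s'_def)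
  have s'k: "s' k = x" "s' (bar k) = - x" by (simp_all add: s'_def)
  have up: "ereal (x - s i) \<le> n $$ (i, k)" "ereal (s i - x) \<le> n $$ (k, i)" if "i \<in> A" for i
  proof -
    have "ereal x \<le> ereal (s i) + n $$ (i, k)" "ereal (- x) \<le> ereal (- s i) + n $$ (k, i)"
      using x(2,3) that by (auto simp: L_def U_def)
    then show "ereal (x - s i) \<le> n $$ (i, k)" "ereal (s i - x) \<le> n $$ (k, i)"
      using that lt k upper_values_neq_MInfty[OF val]
      by (cases "n $$ (i, k)"; cases "n $$ (k, i)"; auto)+
  qed
  \<comment> \<open>By coherence these are the bounds \<open>up\<close> for the partner
    \<open>bar i\<close>.\<close>
  have dn: "ereal (- x - s i) \<le> n $$ (i, bar k)" "ereal (s i + x) \<le> n $$ (bar k, i)" if "i \<in> A" for i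
    using up[OF barA[OF that]] coherent_dbmD[OF co, of i "bar k"] coherent_dbmD[OF co, of "bar k" i]
      sb[OF that] lt[OF that] k by (simp_all add: add.commute minus_diff_commute)
  have "ereal x \<le> n $$ (bar k, k) / 2" "ereal (- x) \<le> n $$ (k, bar k) / 2"
    using x(2,3) by (auto simp: L_def U_def)
  then have un: "ereal (x + x) \<le> n $$ (bar k, k)" "ereal (- x - x) \<le> n $$ (k, bar k)"
    by (cases "n $$ (bar k, k)"; cases "n $$ (k, bar k)"; auto)+
  have "partial_solution n (insert k (insert (bar k) A)) s'"
    unfolding partial_solution_def
    using barA sI sb sA s'A s'k x(1) uminus_mem[OF x(1)] up dn un diag k
    by (auto simp: zero_ereal_def[symmetric])
  then show thesis using that s'A by blast
qed

text \<open>Variables are added in order; one already covered by \<open>A\<close> is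
  skipped.\<close>

lemma partial_solution_complete:
  assumes n: "n \<in> DBM I (2*N)" "strongly_closed N n"
    and A: "A \<subseteq> {..<2*N}" "partial_solution n A s"
  obtains s' where "octagonal_solution N n s'" "\<And>i. i < 2*N \<Longrightarrow> s' i \<in> I"
    "\<And>i. i \<in> A \<Longrightarrow> s' i = s i"
proof -
  have "\<exists>s'. partial_solution n (A \<union> {..<2*k}) s' \<and> (\<forall>i\<in>A. s' i = s i)" if "k \<le> N" for k
    using that
  proof (induction k)
    case 0
    then show ?case using A(2) by auto
  next
    case (Suc k)
    then obtain s1 where s1: "partial_solution n (A \<union> {..<2*k}) s1" "\<forall>i\<in>A. s1 i = s i" by auto
    have eq: "A \<union> {..<2 * Suc k} = insert (2*k) (insert (bar (2*k)) (A \<union> {..<2*k}))" by auto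
    show ?case
    proof (cases "2*k \<in> A")
      case True
      then have "bar (2*k) \<in> A" using A(2) unfolding partial_solution_def by blast
      then have "A \<union> {..<2 * Suc k} = A \<union> {..<2*k}" unfolding eq using True by auto
      then show ?thesis using s1 by metis
    next
      case False
      have "A \<union> {..<2*k} \<subseteq> {..<2*N}" "2*k < 2*N" "2*k \<notin> A \<union> {..<2*k}"
        using A Suc.prems False by auto
      from partial_solution_extend[OF n this(1) s1(1) this(2,3)]
      obtain s2 where "partial_solution n (A \<union> {..<2 * Suc k}) s2" "\<And>i. i \<in> A \<Longrightarrow> s2 i = s1 i"
        unfolding eq by (metis UnI1)
      then show ?thesis using s1 by auto
    qed
  qed
  from this[of N] obtain s' where "partial_solution n (A \<union> {..<2*N}) s'" "\<forall>i\<in>A. s' i = s i" by auto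
  then show thesis
    by (intro that[of s']) (auto simp: octagonal_solution_def partial_solution_def)
qed

text \<open>The remaining freedom is one value \<open>x\<close> at \<open>i\<close>, with
  \<open>x + c\<close> at \<open>j\<close>. Bounding \<open>c\<close> from both sides instead of
  equating it with the entry also covers infinite entries.\<close>

lemma difference_attained:
  assumes n: "n \<in> DBM I (2*N)" "strongly_closed N n" and ij: "i < 2*N" "j < 2*N"
    and c: "c \<in> I" "ereal (- c) \<le> n $$ (j, i)" "ereal c \<le> n $$ (i, j)"
  obtains s where "octagonal_solution N n s" "\<And>i. i < 2*N \<Longrightarrow> s i \<in> I" "s j - s i = c"
proof -
  have co: "coherent_dbm N n" and diag: "\<And>i. i < 2*N \<Longrightarrow> n $$ (i, i) = 0"
    and tri: "\<And>i j c. i < 2*N \<Longrightarrow> j < 2*N \<Longrightarrow> c < 2*N \<Longrightarrow> n $$ (i, j) \<le> n $$ (i, c) + n $$ (c, j)"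
    and str: "\<And>i j. i < 2*N \<Longrightarrow> j < 2*N \<Longrightarrow> n $$ (i, j) \<le> (n $$ (i, bar i) + n $$ (bar j, j)) / 2"
    using n(2) unfolding strongly_closed_def by blast+
  have val: "n $$ (i, j) \<in> upper_values" if "i < 2*N" "j < 2*N" for i j
    using n(1) that by (simp add: DBM_iff)
  have cyc: "0 \<le> n $$ (i, j) + n $$ (j, i)" if "i < 2*N" "j < 2*N" for i j
    using tri[of i i j] diag that by simp
  have "\<exists>A s. A \<subseteq> {..<2*N} \<and> partial_solution n A s \<and> i \<in> A \<and> j \<in> A \<and> s j - s i = c"
  proof -
    consider "j = i" | "j = bar i" | "j \<noteq> i" "j \<noteq> bar i" by blast
    then show ?thesis
    proof cases
      case 1
      \<comment> \<open>The zero diagonal bounds \<open>c\<close> on both sides, so any seed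
        containing \<open>i\<close> works.\<close>
      then have "c = 0" using c diag[of i] ij by (simp add: zero_ereal_def)
      have "partial_solution n {} (\<lambda>_. 0)" by (simp add: partial_solution_def)
      from partial_solution_extend[OF n _ this ij(1)]
      obtain s where "partial_solution n {i, bar i} s" by auto
      then show ?thesis using 1 \<open>c = 0\<close> ij by (intro exI[of _ "{i, bar i}"] exI[of _ s]) auto
    next
      case 2
      \<comment> \<open>Here antisymmetry leaves no freedom: the value at \<open>i\<close> must be
        \<open>- c / 2\<close>.\<close>
      have "c / 2 \<in> I" "- (c / 2) \<in> I" using c half_mem uminus_mem by auto
      then have "partial_solution n {i, bar i} (\<lambda>k. if k = i then - c / 2 else c / 2)"
        using c ij diag 2 by (auto simp: partial_solution_def zero_ereal_def[symmetric])
      then show ?thesis using 2 ij by (intro exI[of _ "{i, bar i}"] exI conjI) auto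
    next
      case 3
      let ?a = "n $$ (i, bar i)" let ?b = "n $$ (bar i, i)"
      let ?d = "n $$ (j, bar j)" let ?e = "n $$ (bar j, j)"
      let ?p = "n $$ (i, bar j)" let ?q = "n $$ (bar j, i)"
      have coh: "n $$ (bar j, bar i) = n $$ (i, j)" "n $$ (bar i, bar j) = n $$ (j, i)"
        "n $$ (j, bar i) = ?p" "n $$ (bar i, j) = ?q"
        using coherent_dbmD[OF co, of i j] coherent_dbmD[OF co, of j i]
          coherent_dbmD[OF co, of i "bar j"] coherent_dbmD[OF co, of "bar j" i] ij by simp_all
      have in_values: "?a \<in> upper_values" "?b \<in> upper_values" "?d \<in> upper_values"
        "?e \<in> upper_values" "?p \<in> upper_values" "?q \<in> upper_values"
        using val ij by simp_all
      \<comment> \<open>Strengthening is what makes the unary bounds at \<open>i\<close> and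
        \<open>j\<close> compatible; triangle inequalities through \<open>bar i\<close> and
        \<open>bar j\<close> give the other mixed bounds.\<close>
      have ae: "ereal c \<le> (?a + ?e) / 2" and db: "ereal (- c) \<le> (?d + ?b) / 2"
        using order_trans[OF c(3) str] order_trans[OF c(2) str] ij by simp_all
      have aq: "ereal c \<le> ?a + ?q" and dq: "ereal (- c) \<le> ?d + ?q"
        and pb: "ereal (- c) \<le> ?p + ?b" and pe: "ereal c \<le> ?p + ?e"
        using order_trans[OF c(3) tri[of i j "bar i"]] order_trans[OF c(2) tri[of j i "bar j"]]
          order_trans[OF c(2) tri[of j i "bar i"]] order_trans[OF c(3) tri[of i j "bar j"]] ij coh by simp_all
      have ab: "0 \<le> ?a + ?b" and de: "0 \<le> ?d + ?e" and pq: "0 \<le> ?p + ?q"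
        using cyc ij by simp_all
      \<comment> \<open>These are the bounds on \<open>x\<close> from the unary entries at
        \<open>i\<close>, from those at \<open>j\<close> applied to \<open>x + c\<close>, and from
        the edges between \<open>i\<close> and \<open>bar j\<close>, whose difference is
        \<open>2 * x + c\<close> up to sign.\<close>
      define L where "L = {?a / 2, ereal c + ?d / 2, (ereal c + ?p) / 2}"
      define U where "U = {?b / 2, ereal (- c) + ?e / 2, (ereal (- c) + ?q) / 2}"
      have "0 \<le> ?a / 2 + ?b / 2"
        "0 \<le> ?a / 2 + (ereal (- c) + ?e / 2)"
        "0 \<le> ?a / 2 + (ereal (- c) + ?q) / 2"
        "0 \<le> (ereal c + ?d / 2) + ?b / 2"
        "0 \<le> (ereal c + ?d / 2) + (ereal (- c) + ?e / 2)"
        "0 \<le> (ereal c + ?d / 2) + (ereal (- c) + ?q) / 2"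
        "0 \<le> (ereal c + ?p) / 2 + ?b / 2"
        "0 \<le> (ereal c + ?p) / 2 + (ereal (- c) + ?e / 2)"
        "0 \<le> (ereal c + ?p) / 2 + (ereal (- c) + ?q) / 2"
        subgoal using ab in_values(1,2) by (auto elim!: upper_values_cases simp: zero_ereal_def)
        subgoal using ae in_values(1,4) by (auto elim!: upper_values_cases simp: zero_ereal_def)
        subgoal using aq in_values(1,6) by
          (auto elim!: upper_values_cases simp: zero_ereal_def add_divide_distrib diff_divide_distrib)
        subgoal using db in_values(3,2) by (auto elim!: upper_values_cases simp: zero_ereal_def)
        subgoal using de in_values(3,4) by (auto elim!: upper_values_cases simp: zero_ereal_def)
        subgoal using dq in_values(3,6) by
          (auto elim!: upper_values_cases simp: zero_ereal_def add_divide_distrib diff_divide_distrib)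
        subgoal using pb in_values(5,2) by
          (auto elim!: upper_values_cases simp: zero_ereal_def add_divide_distrib diff_divide_distrib)
        subgoal using pe in_values(5,4) by
          (auto elim!: upper_values_cases simp: zero_ereal_def add_divide_distrib diff_divide_distrib)
        subgoal using pq in_values(5,6) by
          (auto elim!: upper_values_cases simp: zero_ereal_def add_divide_distrib diff_divide_distrib)
        done
      then have "0 \<le> l + u" if "l \<in> L" "u \<in> U" for l u
        using that unfolding L_def U_def by blast
      moreover have "L \<subseteq> upper_values" "U \<subseteq> upper_values"
        using in_values c uminus_mem unfolding L_def U_def by (auto intro!: upper_values_intros)
      moreover have "finite L" "finite U" by (simp_all add: L_def U_def)
      ultimately obtain x
        where x: "x \<in> I" "\<And>l. l \<in> L \<Longrightarrow> ereal (- x) \<le> l" "\<And>u. u \<in> U \<Longrightarrow> ereal x \<le> u"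
        using between_finite_bounds by metis
      let ?y = "x + c"
      have bounds: "ereal (- x - x) \<le> ?a" "ereal (x + x) \<le> ?b"
        "ereal (- ?y - ?y) \<le> ?d" "ereal (?y + ?y) \<le> ?e"
        "ereal (- ?y - x) \<le> ?p" "ereal (x + ?y) \<le> ?q"
        subgoal using x(2)[of "?a / 2"] in_values(1) by (auto elim!: upper_values_cases simp: L_def)
        subgoal using x(3)[of "?b / 2"] in_values(2) by (auto elim!: upper_values_cases simp: U_def)
        subgoal using x(2)[of "ereal c + ?d / 2"] in_values(3) by (auto elim!: upper_values_cases simp: L_def)
        subgoal using x(3)[of "ereal (- c) + ?e / 2"] in_values(4) by (auto elim!: upper_values_cases simp: U_def)
        subgoal using x(2)[of "(ereal c + ?p) / 2"] in_values(5) by (auto elim!: upper_values_cases simp: L_def)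
        subgoal using x(3)[of "(ereal (- c) + ?q) / 2"] in_values(6) by (auto elim!: upper_values_cases simp: U_def)
        done
      \<comment> \<open>The last branch is meant for \<open>bar j\<close>; values off the four
        indices do not matter.\<close>
      define s where "s = (\<lambda>k. if k = i then x else if k = bar i then - x else if k = j then ?y else - ?y)"
      have ne: "i \<noteq> j" "bar i \<noteq> j" "bar j \<noteq> i" using 3 by auto
      have s: "s i = x" "s (bar i) = - x" "s j = ?y" "s (bar j) = - ?y"
        using 3 ne by (auto simp: s_def)
      have mem: "?y \<in> I" "- ?y \<in> I" "- x \<in> I"
        using x(1) c(1) add_mem uminus_mem by blast+
      have dg: "n $$ (i, i) = 0" "n $$ (bar i, bar i) = 0" "n $$ (j, j) = 0" "n $$ (bar j, bar j) = 0"
        using diag ij by simp_all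
      have "\<forall>u\<in>{i, bar i, j, bar j}. \<forall>v\<in>{i, bar i, j, bar j}. ereal (s v - s u) \<le> n $$ (u, v)"
        using bounds c by (simp add: s dg coh zero_ereal_def[symmetric] algebra_simps)
      then have "partial_solution n {i, bar i, j, bar j} s"
        using mem x(1) by (simp add: partial_solution_def s)
      then show ?thesis using ij s by (intro exI[of _ "{i, bar i, j, bar j}"] exI[of _ s]) auto
    qed
  qed
  then obtain A s0 where A: "A \<subseteq> {..<2*N}" "partial_solution n A s0" "i \<in> A" "j \<in> A" "s0 j - s0 i = c"
    by blast
  show thesis
    using partial_solution_complete[OF n A(1,2)] A(3-5) that by metis
qed

subsection \<open>Normal form\<close>

text \<open>Antisymmetry is automatic for a doubled vector, and closure under negation keeps its
  entries in \<open>I\<close>.\<close>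

lemma oct_domain_iff:
  "v \<in> oct_domain I N n \<longleftrightarrow> v \<in> carrier_vec N \<and> set\<^sub>v v \<subseteq> I \<and> octagonal_solution N n (\<lambda>i. double_vec v $ i)"
proof (cases "v \<in> carrier_vec N \<and> set\<^sub>v v \<subseteq> I")
  case True
  then have dim: "dim_vec v = N" by auto
  have mem: "v $ k \<in> I" if "k < N" for k
    using True that dim by (auto simp: vec_set_def)
  have "set\<^sub>v (double_vec v) \<subseteq> I"
    using mem uminus_mem dim by (auto simp: vec_set_def double_vec_def)
  moreover have "double_vec v $ bar i = - double_vec v $ i" if "i < 2*N" for i
  proof -
    obtain k where "i = 2 * k \<or> i = Suc (2 * k)"
      by (metis evenE oddE Suc_eq_plus1)
    then show ?thesis using that dim by (auto simp: double_vec_def)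
  qed
  ultimately show ?thesis
    using True dim by (auto simp: oct_domain_def dbm_domain_def octagonal_solution_def double_vec_def)
qed (auto simp: oct_domain_def)

lemma oct_domain_of_solution:
  assumes "octagonal_solution N n s" "\<And>i. i < 2*N \<Longrightarrow> s i \<in> I"
  obtains v where "v \<in> oct_domain I N n" "\<And>i. i < 2*N \<Longrightarrow> double_vec v $ i = s i"
proof -
  let ?v = "vec N (\<lambda>k. s (2*k))"
  have eq: "double_vec ?v $ i = s i" if "i < 2*N" for i
  proof (cases "even i")
    case True
    then show ?thesis using that by (auto simp: double_vec_def)
  next
    case False
    then obtain k where k: "i = Suc (2*k)" by (auto elim: oddE)
    then have "s i = - s (2*k)"
      using assms(1) that unfolding octagonal_solution_def by (metis Suc_lessD bar_double(1))
    then show ?thesis using that k by (simp add: double_vec_def)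
  qed
  have "octagonal_solution N n (\<lambda>i. double_vec ?v $ i)"
    using assms(1) by (simp add: octagonal_solution_def eq)
  then have "?v \<in> oct_domain I N n"
    using assms(2) unfolding oct_domain_iff by (auto simp: vec_set_def)
  then show thesis using that eq by blast
qed

lemma strong_closure_DBM:
  assumes "m \<in> DBM I (2*N)"
  shows "strong_closure N m \<in> DBM I (2*N)"
proof -
  have "strong_closure_iter m k \<in> DBM I (2*N)" if "k \<le> N" for k
    using that
  proof (induction k)
    case (Suc k)
    let ?n = "strong_closure_iter m k" let ?c = "C_plus (2*k) ?n"
    have n: "?n \<in> carrier_mat (2*N) (2*N)"
      and val: "\<And>i j. i < 2*N \<Longrightarrow> j < 2*N \<Longrightarrow> ?n $$ (i, j) \<in> upper_values"
      using Suc by (auto simp: DBM_iff)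
    have c: "?c \<in> carrier_mat (2*N) (2*N)" using n by (rule C_plus_carrier)
    have k: "2*k < 2*N" using Suc.prems by simp
    have "?c $$ (i, j) \<in> upper_values" if ij: "i < 2*N" "j < 2*N" for i j
    proof -
      have "?n $$ (i, c) + ?n $$ (c, j) \<in> upper_values"
        "?n $$ (i, c) + ?n $$ (c, d) + ?n $$ (d, j) \<in> upper_values" if "c < 2*N" "d < 2*N" for c d
        using that ij val by (auto intro: upper_values_intros)
      then show ?thesis
        using val[OF ij] k bar_less_double_iff[of "2*k" N] zero_mem_upper_values
        unfolding C_plus_index[OF n ij]
        by (simp del: bar_double bar_less_double_iff add: min_mem_upper_values)
    qed
    then have "S_plus ?c $$ (i, j) \<in> upper_values" if "i < 2*N" "j < 2*N" for i j
      unfolding S_plus_index[OF c that] by (intro upper_values_intros) (use that in auto)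
    moreover have "S_plus ?c \<in> carrier_mat (2*N) (2*N)" using c by (rule S_plus_carrier)
    ultimately show ?case by (simp add: DBM_iff)
  qed (use assms in simp)
  then show ?thesis by (simp add: strong_closure_def)
qed

text \<open>The closure keeps every solution of \<open>m\<close>, and its entries are no larger, so
  it admits no new ones.\<close>

lemma oct_domain_strong_closure:
  assumes "m \<in> DBM I (2*N)" "coherent_dbm N m" "oct_domain I N m \<noteq> {}"
  shows "oct_domain I N (strong_closure N m) = oct_domain I N m"
proof -
  have m: "m \<in> carrier_mat (2*N) (2*N)" using assms(1) by (simp add: DBM_iff)
  obtain v where v: "octagonal_solution N m (\<lambda>i. double_vec v $ i)"
    using assms(3) by (auto simp: oct_domain_iff)
  have "octagonal_solution N (strong_closure N m) s \<longleftrightarrow> octagonal_solution N m s" for s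
    using octagonal_solution_strong_closure[OF m assms(2)]
      octagonal_solution_mono[OF _ strong_closure_le[OF m assms(2) v]] by blast
  then show ?thesis by (auto simp: oct_domain_iff)
qed

text \<open>Where \<open>n\<close> is infinite, every large enough natural number is an attained difference.\<close>
lemma strongly_closed_le:
  assumes n: "n \<in> DBM I (2*N)" "strongly_closed N n"
    and n': "oct_domain I N n \<subseteq> oct_domain I N n'" and ij: "i < 2*N" "j < 2*N"
  shows "n $$ (i, j) \<le> n' $$ (i, j)"
proof -
  have bound: "ereal c \<le> n' $$ (i, j)"
    if c: "c \<in> I" "ereal (- c) \<le> n $$ (j, i)" "ereal c \<le> n $$ (i, j)" for c
  proof -
    obtain s where s: "octagonal_solution N n s" "\<And>i. i < 2*N \<Longrightarrow> s i \<in> I" "s j - s i = c"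
      using difference_attained[OF n ij c] by blast
    obtain v where v: "v \<in> oct_domain I N n" "\<And>i. i < 2*N \<Longrightarrow> double_vec v $ i = s i"
      using oct_domain_of_solution[OF s(1,2)] by blast
    then have "v \<in> oct_domain I N n'" using n' by blast
    then have "octagonal_solution N n' (\<lambda>i. double_vec v $ i)" by (simp add: oct_domain_iff)
    then show ?thesis
      using v(2) s(3) ij unfolding octagonal_solution_def by metis
  qed
  have val: "n $$ (i, j) \<in> upper_values" "n $$ (j, i) \<in> upper_values"
    using n(1) ij by (simp_all add: DBM_iff)
  have cyc: "0 \<le> n $$ (i, j) + n $$ (j, i)"
    using n(2) ij unfolding strongly_closed_def by metis
  from val(1) show ?thesis
  proof (cases rule: upper_values_cases)
    case (1 r)
    then have "ereal (- r) \<le> n $$ (j, i)" using cyc by (cases "n $$ (j, i)") (auto simp: zero_ereal_def)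
    then show ?thesis using bound[of r] 1 by simp
  next
    case 2
    show ?thesis
    proof (cases "n' $$ (i, j) = \<infinity>")
      case False
      obtain K where K: "ereal (- real K) \<le> n $$ (j, i)"
      proof (cases "n $$ (j, i)")
        case (real r)
        obtain K where "- r \<le> real K" using real_arch_simple by blast
        then show ?thesis using that[of K] real by simp
      qed (use val that in \<open>auto dest: upper_values_neq_MInfty\<close>)
      obtain B where B: "n' $$ (i, j) \<le> ereal (real B)"
      proof (cases "n' $$ (i, j)")
        case (real r)
        obtain K where "r \<le> real K" using real_arch_simple by blast
        then show ?thesis using that[of K] real by simp
      qed (use False that in auto)
      \<comment> \<open>\<open>K\<close> keeps this difference compatible with the opposite entry of
        \<open>n\<close>, while \<open>B\<close> makes it exceed the entry of \<open>n'\<close>, a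
        contradiction.\<close>
      have "ereal (- real (Suc (K + B))) \<le> n $$ (j, i)"
        by (rule order_trans[OF _ K]) simp
      then have "ereal (real (Suc (K + B))) \<le> n' $$ (i, j)"
        using 2 by (intro bound of_nat_mem) (simp_all only: ereal_less_eq)
      from order_trans[OF this B] show ?thesis by simp
    qed simp
  qed
qed

end

section \<open>Assembly for the rationals and the reals\<close>

lemma half_closed_group_Rats_Reals: "I \<in> {\<rat>, \<real>} \<Longrightarrow> half_closed_group I"
  by unfold_locales auto

theorem theorem4:
  fixes I :: "real set" and N :: nat and m :: "ereal mat"
  assumes "I \<in> {\<rat>, \<real>}"
    and "N \<ge> 1"
    and "m \<in> DBM I (2*N)"
    and "coherent_dbm N m"
    and "oct_domain I N m \<noteq> {}"
  shows "(m = strong_closure N m \<longleftrightarrow> strongly_closed N m) \<and>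
    (\<forall>i<2*N. \<forall>j<2*N. strong_closure N m $$ (i, j) \<noteq> \<infinity> \<longrightarrow>
       (\<exists>s \<in> dbm_domain I (2*N) m.
          (\<forall>k<N. s $ (2*k) = - (s $ (2*k + 1))) \<and>
          ereal (s $ j - s $ i) = strong_closure N m $$ (i, j))) \<and>
    is_glb (dbm_order I (2*N)) (strong_closure N m)
      {n. n \<in> DBM I (2*N) \<and> coherent_dbm N n \<and> oct_domain I N n = oct_domain I N m}"
proof -
  interpret half_closed_group I using assms(1) by (rule half_closed_group_Rats_Reals)
  let ?M = "strong_closure N m"
  have m: "m \<in> carrier_mat (2*N) (2*N)" using assms(3) by (simp add: DBM_iff)
  obtain v where "octagonal_solution N m (\<lambda>i. double_vec v $ i)"
    using assms(5) by (auto simp: oct_domain_iff)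
  then have closed: "strongly_closed N ?M"
    using strongly_closed_strong_closure m assms(2,4) by blast
  have M: "?M \<in> DBM I (2*N)" using assms(3) by (rule strong_closure_DBM)
  have dom: "oct_domain I N ?M = oct_domain I N m"
    using assms(3-5) by (rule oct_domain_strong_closure)
  have fixpoint: "m = ?M \<longleftrightarrow> strongly_closed N m"
    using closed strong_closure_of_strongly_closed[OF m] by metis
  have saturated: "\<exists>s \<in> dbm_domain I (2*N) m. (\<forall>k<N. s $ (2*k) = - (s $ (2*k + 1))) \<and>
      ereal (s $ j - s $ i) = ?M $$ (i, j)"
    if ij: "i < 2*N" "j < 2*N" and fin: "?M $$ (i, j) \<noteq> \<infinity>" for i j
  proof -
    have "?M $$ (i, j) \<in> upper_values" using M ij by (simp add: DBM_iff)
    then obtain c where c: "c \<in> I" "?M $$ (i, j) = ereal c"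
      using fin by (auto elim: upper_values_cases)
    have "0 \<le> ?M $$ (i, j) + ?M $$ (j, i)"
      using closed ij unfolding strongly_closed_def by metis
    then have "ereal (- c) \<le> ?M $$ (j, i)"
      using c(2) by (cases "?M $$ (j, i)") (auto simp: zero_ereal_def)
    then obtain s where s: "octagonal_solution N ?M s" "\<And>i. i < 2*N \<Longrightarrow> s i \<in> I" "s j - s i = c"
      using difference_attained[OF M closed ij c(1)] c(2) by auto
    obtain w where w: "w \<in> oct_domain I N ?M" "\<And>i. i < 2*N \<Longrightarrow> double_vec w $ i = s i"
      using oct_domain_of_solution[OF s(1,2)] by blast
    \<comment> \<open>The witness was built for the closure; equality of the domains carries it back
      to \<open>m\<close>.\<close>
    have "double_vec w \<in> dbm_domain I (2*N) m"
      using w(1) unfolding dom by (simp add: oct_domain_def)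
    moreover have "\<forall>k<N. double_vec w $ (2*k) = - (double_vec w $ (2*k + 1))"
      using w(1) by (auto simp: oct_domain_def double_vec_def)
    moreover have "ereal (double_vec w $ j - double_vec w $ i) = ?M $$ (i, j)"
      using w(2) s(3) c(2) ij by simp
    ultimately show ?thesis by blast
  qed
  have glb: "is_glb (dbm_order I (2*N)) ?M
      {n. n \<in> DBM I (2*N) \<and> coherent_dbm N n \<and> oct_domain I N n = oct_domain I N m}" (is "is_glb ?O ?M ?A")
  proof -
    have le: "?M \<le> n" if "n \<in> ?A" for n
      using strongly_closed_le[OF M closed, of n] that dom M
      by (auto simp: less_eq_mat_def DBM_iff)
    \<comment> \<open>The infimum is a minimum: since the closure belongs to the set, every lower
      bound lies below it.\<close>
    have "?M \<in> ?A" using M closed dom by (simp add: strongly_closed_def)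
    then have "x \<le> ?M" if "x \<in> Lower ?O ?A" for x
      using that M by (simp add: Lower_def dbm_order_def)
    moreover have "?M \<in> Lower ?O ?A"
      using M le by (simp add: Lower_def dbm_order_def)
    moreover have "Lower ?O ?A \<subseteq> carrier ?O" by (rule Lower_closed)
    moreover have "le ?O = (\<le>)" by (simp add: dbm_order_def)
    ultimately show ?thesis unfolding greatest_def by simp
  qed
  show ?thesis
    by (rule conjI[OF fixpoint conjI[OF _ glb]]) (intro allI impI saturated)
qed

end
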